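(* Let $r$ be a positive integer. Let $(S_n(X))_{n\ge 0}$ be the Carlitz-type $q$-polynomial sequence associated to the real sequence $a_k=\frac{1}{q-1}\cdot\frac{1}{[k+r]}$ ($k\ge 0$). Then for every integer $n\ge 0$ and every positive integer $N$, $$\sum_{k=0}^{N-1}q^{rk}[k]^n=q^{rN}S_n(N)-S_n(0).$$
   Context: Let $q$ be a positive real number, $q\neq 1$, and put $[X]:=\frac{q^X-1}{q-1}$. The Carlitz-type $q$-polynomial sequence associated to a real sequence $(a_k)_{k\ge 0}$ is the sequence $(T_n(X))_{n\ge 0}$ defined by $$T_n(X)=(q-1)^{-n}\sum_{k=0}^{n}(-1)^{n-k}\binom{n}{k}a_k\,q^{kX}.$$ The convention $[k]^0=1$ (also for $k=0$) is used. *)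

theory Defs
  imports Complex_Main
begin

definition qbracket :: "real \<Rightarrow> real \<Rightarrow> real" where
  "qbracket q X = (q powr X - 1) / (q - 1)"

text \<open>A \<open>q\<close>-polynomial is represented by the function of the real variable \<open>X\<close> it defines.
  Real powers \<open>q powr X\<close> are meant for \<open>q > 0\<close>; the base \<open>q - 1\<close> may be negative,
  so its negative power is an integer power.\<close>

definition carlitz_type :: "real \<Rightarrow> (nat \<Rightarrow> real) \<Rightarrow> nat \<Rightarrow> real \<Rightarrow> real" where
  "carlitz_type q a n X =
     (q - 1) powi (- int n) *
     (\<Sum>k=0..n. (-1) ^ (n - k) * real (n choose k) * a k * q powr (real k * X))"

end

theory Submission
  imports Defs
begin

text \<open>Here \<open>a k = 1 / (q ^ (k + r) - 1)\<close>, so in the difference of \<open>q ^ (r * M) * S n M\<close> at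
  \<open>M + 1\<close> and \<open>M\<close> the factor \<open>q ^ (k + r) - 1\<close> cancels \<open>a k\<close>, and the binomial theorem turns
  what remains into \<open>q ^ (r * M) * [M] ^ n\<close>. Summing over \<open>M\<close> telescopes.\<close>

lemma qbracket_of_nat:
  assumes "q > 0"
  shows "qbracket q (real m) = (q ^ m - 1) / (q - 1)"
  using assms by (simp add: qbracket_def powr_realpow)

text \<open>At natural arguments all real and integer powers become natural powers, so the later
  steps are ring algebra over the common denominator \<open>(q - 1) ^ n\<close>.\<close>

lemma carlitz_type_of_nat:
  assumes "q > 0"
  shows "carlitz_type q a n (real M) =
    (\<Sum>k\<le>n. (-1) ^ (n - k) * real (n choose k) * a k * q ^ (k * M)) / (q - 1) ^ n"
proof -
  have "q powr (real k * real M) = q ^ (k * M)" for k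
    using assms by (simp add: powr_realpow flip: of_nat_mult)
  then show ?thesis
    by (simp add: carlitz_type_def power_int_minus atMost_atLeast0 field_simps)
qed

lemma power_neq_1:
  fixes q :: real
  assumes "q > 0" "q \<noteq> 1" "m > 0"
  shows "q ^ m \<noteq> 1"
  using assms power_eq_iff_eq_base[of m q 1] by auto

lemma carlitz_type_difference:
  assumes q: "q > 0" "q \<noteq> 1" and a: "\<And>k. a k * (q ^ (k + r) - 1) = 1"
  shows "q ^ (r * Suc M) * carlitz_type q a n (real (Suc M)) - q ^ (r * M) * carlitz_type q a n (real M)
    = q ^ (r * M) * qbracket q (real M) ^ n"
proof -
  \<comment> \<open>\<open>c\<close> stands for the signed binomial coefficient; the cancellation
    happens separately in each summand.\<close>
  have cancel: "q ^ (r * Suc M) * (c * a k * q ^ (k * Suc M)) - q ^ (r * M) * (c * a k * q ^ (k * M))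
      = q ^ (r * M) * (c * q ^ (k * M))" for k c
  proof -
    have "q ^ (r * Suc M) * (c * a k * q ^ (k * Suc M)) - q ^ (r * M) * (c * a k * q ^ (k * M))
      = q ^ (r * M) * (c * q ^ (k * M)) * (a k * (q ^ (k + r) - 1))"
      by (simp add: power_add algebra_simps)
    then show ?thesis by (simp add: a)
  qed
  have "(q ^ M - 1) ^ n = (\<Sum>k\<le>n. (-1) ^ (n - k) * real (n choose k) * q ^ (k * M))"
    using binomial_ring[of "q ^ M" "-1" n] by (simp add: mult_ac flip: power_mult)
  then show ?thesis
    unfolding carlitz_type_of_nat[OF q(1)] qbracket_of_nat[OF q(1)] power_divide
    by (simp only: times_divide_eq_right sum_distrib_left cancel
        flip: diff_divide_distrib sum_subtractf)
qed

theorem theorem2p6: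
  fixes q :: real and r :: nat and a :: "nat \<Rightarrow> real" and S :: "nat \<Rightarrow> real \<Rightarrow> real"
    and n N :: nat
  assumes "q > 0" and "q \<noteq> 1" and "r > 0"
    and "\<And>k. a k = 1 / (q - 1) * (1 / qbracket q (real (k + r)))"
    and "S = carlitz_type q a"
    and "N > 0"
  shows "(\<Sum>k=0..N-1. q ^ (r * k) * qbracket q (real k) ^ n)
           = q ^ (r * N) * S n (real N) - S n 0"
proof -
  \<comment> \<open>The factor \<open>1 / (q - 1)\<close> absorbs the denominator of the bracket;
    \<open>r > 0\<close> keeps \<open>q ^ (k + r) - 1\<close> nonzero even at
    \<open>k = 0\<close>.\<close>
  have a: "a k * (q ^ (k + r) - 1) = 1" for k
    using assms(1-3) power_neq_1[of q "k + r"]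
    unfolding assms(4) qbracket_of_nat[OF assms(1)] by simp
  \<comment> \<open>Needs \<open>N > 0\<close>: truncated subtraction would give \<open>{0}\<close>
    at \<open>N = 0\<close>.\<close>
  have "{0..N-1} = {..<N}"
    using assms(6) by auto
  then have "(\<Sum>k=0..N-1. q ^ (r * k) * qbracket q (real k) ^ n)
      = (\<Sum>k<N. q ^ (r * Suc k) * S n (real (Suc k)) - q ^ (r * k) * S n (real k))"
    unfolding assms(5) using carlitz_type_difference[OF assms(1,2) a] by simp
  also have "\<dots> = q ^ (r * N) * S n (real N) - S n 0"
    using sum_lessThan_telescope[of "\<lambda>k. q ^ (r * k) * S n (real k)" N] by simp
  finally show ?thesis .
qed

end
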